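(* Let $\mathcal{G}$ be a DAG, let $\mathbb{Z}$ be a finite collection of realizations $\mathbf{z}$ of subsets $\mathbf{Z}\subseteq\mathbf{V}$, and suppose the interventional distributions $\{P(\mathbf{V}_{\mathbf{z}}):\mathbf{z}\in\mathbb{Z}\}$ are given. Fix a counterfactual event $(\mathbf{y}_{\mathbf{x}},\dots,\mathbf{z}_{\mathbf{w}})$. Let $l$ and $r$ be, respectively, the minimum and maximum of $P_N(\mathbf{y}_{\mathbf{x}},\dots,\mathbf{z}_{\mathbf{w}})$ over $N\in\mathcal{N}(\mathcal{G})$ subject to $P_N(\mathbf{v}_{\mathbf{z}})=P(\mathbf{v}_{\mathbf{z}})$ for all $\mathbf{v}$ and all $\mathbf{z}\in\mathbb{Z}$ (a polynomial program in the parameters of the canonical SCMs). Then $[l,r]$ is a tight bound on $P(\mathbf{y}_{\mathbf{x}},\dots,\mathbf{z}_{\mathbf{w}})$: $l$ and $r$ are equal, respectively, to the minimum and maximum of $P_M(\mathbf{y}_{\mathbf{x}},\dots,\mathbf{z}_{\mathbf{w}})$ over all $M\in\mathcal{M}(\mathcal{G})$ subject to $P_M(\mathbf{v}_{\mathbf{z}})=P(\mathbf{v}_{\mathbf{z}})$ for all $\mathbf{v}$ and all $\mathbf{z}\in\mathbb{Z}$.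
   Context: An SCM $M=\langle\mathbf{V},\mathbf{U},\mathcal{F},P\rangle$ consists of a finite set $\mathbf{V}$ of endogenous variables with finite domains $\Omega_V$; a finite set $\mathbf{U}$ of mutually independent exogenous variables with arbitrary domains and probability measures; and functions $v\gets f_V(pa_V,u_V)$, $PA_V\subseteq\mathbf{V}$, $U_V\subseteq\mathbf{U}$. Its causal diagram has nodes $\mathbf{V}\cup\mathbf{U}$ and arrows from $PA_V\cup U_V$ into $V$, assumed acyclic; $M$ is compatible with $\mathcal{G}$ if its diagram equals $\mathcal{G}$. Potential responses $\mathbf{Y}_{\mathbf{x}}(\mathbf{u})$ are the solutions for $\mathbf{Y}$ in the submodel where variables in $\mathbf{X}$ are set to the constants $\mathbf{x}$, given $\mathbf{U}=\mathbf{u}$, and $P_M(\mathbf{y}_{\mathbf{x}},\dots,\mathbf{z}_{\mathbf{w}})$ is the probability (under the exogenous distribution) that $\mathbf{Y}_{\mathbf{x}}(\mathbf{u})=\mathbf{y},\dots,\mathbf{Z}_{\mathbf{w}}(\mathbf{u})=\mathbf{z}$; $P(\mathbf{v}_{\mathbf{z}})$ is the case $\mathbf{Y}=\mathbf{V}$, and $\mathbf{z}=\emptyset$ gives the observational distribution. $\mathcal{M}(\mathcal{G})$ is the set of all SCMs compatible with $\mathcal{G}$. $\mathcal{N}(\mathcal{G})$ is the set of SCMs compatible with $\mathcal{G}$ in which every exogenous $U$ has a discrete domain of cardinality $\prod_{V\in\mathbf{C}(U)}|\Omega_{PA_V}\mapsto\Omega_V|$, where $\Omega_{PA_V}\mapsto\Omega_V$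 is the set of all functions from $\Omega_{PA_V}$ to $\Omega_V$ and $\mathbf{C}(U)$ is the set of all $V\in\mathbf{V}$ for which there is a sequence $U_1=U,\dots,U_n\in\mathbf{U}$ with $U_n\in U_V$ and consecutive $U_i,U_{i+1}$ having a common child in $\mathcal{G}$. *)

theory Defs
  imports "HOL-Probability.Probability"
begin

(* Causal diagram: endogenous variables 'v, exogenous variables 'u.
   pa V  = PA_V  (endogenous parents of V),
   ex V  = U_V   (exogenous parents of V).
   The endogenous part must be acyclic (exogenous nodes are roots). *)
definition dag :: "('v \<Rightarrow> 'v set) \<Rightarrow> bool" where
  "dag pa \<longleftrightarrow> acyclic {(W, V). W \<in> pa V}"

(* a (partial) realization x of a set X = dom x of endogenous variables *)
definition realization :: "('v \<Rightarrow> 'd set) \<Rightarrow> ('v \<rightharpoonup> 'd) \<Rightarrow> bool" where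
  "realization \<Omega> x \<longleftrightarrow> (\<forall>V c. x V = Some c \<longrightarrow> c \<in> \<Omega> V)"

(* An SCM compatible with the diagram (pa, ex): exogenous variables U have
   (mutually independent) probability spaces mu U; the joint exogenous law is
   the product measure.  f V w u is the structural function of V; it may only
   depend on w restricted to pa V and u restricted to ex V. *)
definition compatible_scm ::
  "('v \<Rightarrow> 'v set) \<Rightarrow> ('v \<Rightarrow> 'u set) \<Rightarrow> ('v \<Rightarrow> 'd set)
   \<Rightarrow> ('u \<Rightarrow> 'e measure) \<Rightarrow> ('v \<Rightarrow> ('v \<Rightarrow> 'd) \<Rightarrow> ('u \<Rightarrow> 'e) \<Rightarrow> 'd) \<Rightarrow> bool" where
  "compatible_scm pa ex \<Omega> \<mu> f \<longleftrightarrow>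
     (\<forall>U. prob_space (\<mu> U)) \<and>
     (\<forall>V w. (\<lambda>u. f V w u) \<in> measurable (PiM UNIV \<mu>) (count_space UNIV)) \<and>
     (\<forall>V w u. u \<in> space (PiM UNIV \<mu>) \<longrightarrow> f V w u \<in> \<Omega> V) \<and>
     (\<forall>V w w' u u'. (\<forall>W\<in>pa V. w W = w' W) \<longrightarrow> (\<forall>U\<in>ex V. u U = u' U)
         \<longrightarrow> f V w u = f V w' u')"

(* potential response V_x(u): the solution of the submodel M_x given U = u *)
definition resp ::
  "('v \<Rightarrow> ('v \<Rightarrow> 'd) \<Rightarrow> ('u \<Rightarrow> 'e) \<Rightarrow> 'd) \<Rightarrow> ('v \<rightharpoonup> 'd) \<Rightarrow> ('u \<Rightarrow> 'e) \<Rightarrow> ('v \<Rightarrow> 'd)" where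
  "resp f x u = (THE v. \<forall>V. v V = (case x V of Some c \<Rightarrow> c | None \<Rightarrow> f V v u))"

(* counterfactual event (y_x, ..., z_w), given as the list of pairs (x, y), (w, z), ... *)
definition cf_holds ::
  "('v \<Rightarrow> ('v \<Rightarrow> 'd) \<Rightarrow> ('u \<Rightarrow> 'e) \<Rightarrow> 'd) \<Rightarrow> (('v \<rightharpoonup> 'd) \<times> ('v \<rightharpoonup> 'd)) list
   \<Rightarrow> ('u \<Rightarrow> 'e) \<Rightarrow> bool" where
  "cf_holds f evs u \<longleftrightarrow> (\<forall>(x, y) \<in> set evs. \<forall>V \<in> dom y. y V = Some (resp f x u V))"

definition cf_prob ::
  "('u \<Rightarrow> 'e measure) \<Rightarrow> ('v \<Rightarrow> ('v \<Rightarrow> 'd) \<Rightarrow> ('u \<Rightarrow> 'e) \<Rightarrow> 'd)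
   \<Rightarrow> (('v \<rightharpoonup> 'd) \<times> ('v \<rightharpoonup> 'd)) list \<Rightarrow> real" where
  "cf_prob \<mu> f evs = measure (PiM UNIV \<mu>) {u \<in> space (PiM UNIV \<mu>). cf_holds f evs u}"

definition feasible ::
  "('v \<Rightarrow> 'v set) \<Rightarrow> ('v \<Rightarrow> 'u set) \<Rightarrow> ('v \<Rightarrow> 'd set) \<Rightarrow> ('v \<rightharpoonup> 'd) set
   \<Rightarrow> (('v \<rightharpoonup> 'd) \<Rightarrow> ('v \<Rightarrow> 'd) \<Rightarrow> real)
   \<Rightarrow> ('u \<Rightarrow> 'e measure) \<Rightarrow> ('v \<Rightarrow> ('v \<Rightarrow> 'd) \<Rightarrow> ('u \<Rightarrow> 'e) \<Rightarrow> 'd) \<Rightarrow> bool" where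
  "feasible pa ex \<Omega> Zs Pdist \<mu> f \<longleftrightarrow>
     compatible_scm pa ex \<Omega> \<mu> f \<and>
     (\<forall>z\<in>Zs. \<forall>v. (\<forall>V. v V \<in> \<Omega> V) \<longrightarrow> cf_prob \<mu> f [(z, Some \<circ> v)] = Pdist z v)"

definition share_child :: "('v \<Rightarrow> 'u set) \<Rightarrow> ('u \<times> 'u) set" where
  "share_child ex = {(U1, U2). \<exists>V. U1 \<in> ex V \<and> U2 \<in> ex V}"

definition c_comp :: "('v \<Rightarrow> 'u set) \<Rightarrow> 'u \<Rightarrow> 'v set" where
  "c_comp ex U = {V. \<exists>U'. (U, U') \<in> (share_child ex)\<^sup>* \<and> U' \<in> ex V}"

definition canon_card ::
  "('v \<Rightarrow> 'v set) \<Rightarrow> ('v \<Rightarrow> 'u set) \<Rightarrow> ('v \<Rightarrow> 'd set) \<Rightarrow> 'u \<Rightarrow> nat" where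
  "canon_card pa ex \<Omega> U =
     (\<Prod>V\<in>c_comp ex U. card (PiE (PiE (pa V) \<Omega>) (\<lambda>_. \<Omega> V)))"

definition canonical ::
  "('v \<Rightarrow> 'v set) \<Rightarrow> ('v \<Rightarrow> 'u set) \<Rightarrow> ('v \<Rightarrow> 'd set) \<Rightarrow> ('u \<Rightarrow> 'e measure) \<Rightarrow> bool" where
  "canonical pa ex \<Omega> \<mu> \<longleftrightarrow>
     (\<forall>U. \<exists>D. finite D \<and> card D = canon_card pa ex \<Omega> U \<and> sets (\<mu> U) = sets (count_space D))"

end

(* Every SCM is counterfactually equivalent to a canonical one. All counterfactual events are
   functions of the response functions (f_V(., u))_V, so only their joint law has to be preserved.
   Fix an exogenous variable U. The response functions inside the c-component of U are independent
   of the others, which do not depend on U, and their law is the mean over U of their conditional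
   law given U = s. This mean lies in the convex hull of the conditional laws (also when that hull
   is not closed), hence by Caratheodory's theorem it is a combination of as many of them as there
   are tuples of response functions of the c-component. So U can be given a discrete law with that
   many atoms; doing this for one exogenous variable after the other gives the canonical model. *)

theory Submission
  imports Defs
begin

subsection \<open>Moments of finitely supported distributions\<close>

text \<open>Gaussian elimination, by induction on the equations: equation \<open>i\<close> is solved
  for the unknown at a pivot \<open>p\<close> with \<open>X i p \<noteq> 0\<close>, and substitution
  into the other equations leaves a smaller system that still has more unknowns than
  equations.\<close>

lemma exists_nontrivial_relation:
  fixes X :: "'i \<Rightarrow> 's \<Rightarrow> real"
  assumes "finite I" "finite S" "card I < card S"
  shows "\<exists>c. (\<exists>s\<in>S. c s \<noteq> 0) \<and> (\<forall>i\<in>I. (\<Sum>s\<in>S. c s * X i s) = 0)"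
  using assms
proof (induction I arbitrary: S X rule: finite_induct)
  case empty
  then show ?case by (intro exI[of _ "\<lambda>_. 1"]) (auto simp: card_gt_0_iff)
next
  case (insert i I)
  show ?case
  proof (cases "\<forall>s\<in>S. X i s = 0")
    case True
    with insert.IH[of S X] insert.prems insert.hyps show ?thesis by auto
  next
    case False
    then obtain p where p: "p \<in> S" "X i p \<noteq> 0" by blast
    let ?S = "S - {p}"
    have "card I < card ?S" using insert p by simp
    with insert.IH[of ?S "\<lambda>j s. X j s - X j p * X i s / X i p"] insert.prems
    obtain c where c: "\<exists>s\<in>?S. c s \<noteq> 0"
      "\<And>j. j \<in> I \<Longrightarrow> (\<Sum>s\<in>?S. c s * (X j s - X j p * X i s / X i p)) = 0" by auto
    \<comment> \<open>The value that equation \<open>i\<close> forces on the pivot unknown.\<close>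
    let ?k = "- (\<Sum>s\<in>?S. c s * X i s) / X i p"
    let ?d = "c(p := ?k)"
    have split: "(\<Sum>s\<in>S. ?d s * X j s) = ?k * X j p + (\<Sum>s\<in>?S. c s * X j s)" for j
      using insert.prems p(1) by (subst sum.remove[of S p]) (auto intro!: sum.cong)
    have "(\<Sum>s\<in>S. ?d s * X j s) = 0" if "j \<in> I" for j
    proof -
      have "0 = (\<Sum>s\<in>?S. c s * X j s - X j p / X i p * (c s * X i s))"
        using c(2)[OF that] by (simp add: algebra_simps)
      also have "\<dots> = (\<Sum>s\<in>?S. c s * X j s) - X j p / X i p * (\<Sum>s\<in>?S. c s * X i s)"
        by (simp only: sum_subtractf sum_distrib_left)
      finally show ?thesis unfolding split by (simp add: algebra_simps)
    qed
    moreover have "(\<Sum>s\<in>S. ?d s * X i s) = 0" unfolding split using p(2) by simp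
    moreover have "\<exists>s\<in>S. ?d s \<noteq> 0" using c(1) by auto
    ultimately show ?thesis by (intro exI[of _ ?d]) auto
  qed
qed

text \<open>While there are more points than coordinates, a linear relation among the points allows
  the weights to be shifted until one of them vanishes, and that point is dropped. The total weight
  is not preserved; in return the bound is \<open>card I\<close> rather than
  \<open>card I + 1\<close>.\<close>

lemma conic_caratheodory:
  fixes X :: "'i \<Rightarrow> 's \<Rightarrow> real"
  assumes "finite I" "finite S" "\<And>s. s \<in> S \<Longrightarrow> 0 \<le> w s"
  shows "\<exists>T v. T \<subseteq> S \<and> card T \<le> card I \<and> (\<forall>s\<in>T. 0 \<le> v s) \<and>
           (\<forall>i\<in>I. (\<Sum>s\<in>T. v s * X i s) = (\<Sum>s\<in>S. w s * X i s))"
  using assms(2,3)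
proof (induction "card S" arbitrary: S w rule: less_induct)
  case less
  show ?case
  proof (cases "card S \<le> card I")
    case True
    then show ?thesis using less.prems by auto
  next
    case False
    then obtain c0 where c0: "\<exists>s\<in>S. c0 s \<noteq> 0" "\<And>i. i \<in> I \<Longrightarrow> (\<Sum>s\<in>S. c0 s * X i s) = 0"
      using exists_nontrivial_relation[OF assms(1) less.prems(1), of X] by auto
    \<comment> \<open>The sign of the relation is chosen so that subtracting a multiple of it
      decreases some weight.\<close>
    obtain c where c: "\<exists>s\<in>S. c s > 0" "\<And>i. i \<in> I \<Longrightarrow> (\<Sum>s\<in>S. c s * X i s) = 0"
    proof (cases "\<exists>s\<in>S. c0 s > 0")
      case True
      then show ?thesis using that c0 by blast
    next
      case False
      with c0(1) have "\<exists>s\<in>S. - c0 s > 0" by force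
      then show ?thesis using that[of "\<lambda>s. - c0 s"] c0(2) by (simp add: sum_negf)
    qed
    let ?P = "{s\<in>S. c s > 0}"
    have P: "finite ?P" "?P \<noteq> {}" using less.prems c(1) by auto
    \<comment> \<open>The largest multiple of \<open>c\<close> that can be subtracted with all
      weights staying nonnegative; a point attaining the minimum ends with weight 0.\<close>
    define t where "t = Min ((\<lambda>s. w s / c s) ` ?P)"
    have "t \<in> (\<lambda>s. w s / c s) ` ?P" unfolding t_def using P by (intro Min_in) auto
    then obtain p where p: "p \<in> S" "c p > 0" "t = w p / c p" by auto
    have t0: "0 \<le> t" using p less.prems by simp
    have tle: "t \<le> w s / c s" if "s \<in> S" "c s > 0" for s
      unfolding t_def using P that by (intro Min_le) auto
    let ?v = "\<lambda>s. w s - t * c s"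
    have v: "0 \<le> ?v s" if s: "s \<in> S" for s
    proof (cases "c s > 0")
      case True
      with tle[OF s] show ?thesis by (simp add: field_simps)
    next
      case False
      then have "t * c s \<le> 0" using t0 by (intro mult_nonneg_nonpos) auto
      then show ?thesis using less.prems(2)[OF s] by simp
    qed
    have sum_v: "(\<Sum>s\<in>S - {p}. ?v s * X i s) = (\<Sum>s\<in>S. w s * X i s)" if "i \<in> I" for i
    proof -
      have "(\<Sum>s\<in>S. w s * X i s) = (\<Sum>s\<in>S. ?v s * X i s) + t * (\<Sum>s\<in>S. c s * X i s)"
        by (simp add: sum_distrib_left sum.distrib[symmetric] algebra_simps)
      also have "\<dots> = (\<Sum>s\<in>S - {p}. ?v s * X i s)"
        using c(2)[OF that] p less.prems(1) by (simp add: sum.remove[of S p])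
      finally show ?thesis by simp
    qed
    have "card (S - {p}) < card S" using p less.prems by (intro psubset_card_mono) auto
    from less.hyps[OF this, of ?v] less.prems v
    obtain T u where T: "T \<subseteq> S - {p}" "card T \<le> card I" "\<forall>s\<in>T. 0 \<le> u s"
      "\<forall>i\<in>I. (\<Sum>s\<in>T. u s * X i s) = (\<Sum>s\<in>S - {p}. ?v s * X i s)" by auto
    then show ?thesis using sum_v by (intro exI[of _ T] exI[of _ u]) auto
  qed
qed

section \<open>Separating the origin from a convex hull\<close>

lemma compact_box_fun:
  fixes B :: "'i \<Rightarrow> 'b::topological_space set"
  assumes "\<And>i. compact (B i)"
  shows "compact (Pi UNIV B)"
  using compactin_PiE[of "\<lambda>_::'i. euclidean :: 'b topology" UNIV B] assms
  by (simp add: euclidean_product_topology PiE_UNIV_domain)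

text \<open>The functional is the point of least norm in the convex hull.\<close>

lemma finite_gordan:
  fixes X :: "'i \<Rightarrow> 's \<Rightarrow> real"
  assumes I: "finite I" and S: "finite S" "S \<noteq> {}"
    and no: "\<And>w. (\<And>s. s \<in> S \<Longrightarrow> 0 \<le> w s) \<Longrightarrow> sum w S = 1 \<Longrightarrow> \<exists>i\<in>I. (\<Sum>s\<in>S. w s * X i s) \<noteq> 0"
  shows "\<exists>a. (\<Sum>i\<in>I. (a i)\<^sup>2) = 1 \<and> (\<forall>s\<in>S. 0 \<le> (\<Sum>i\<in>I. a i * X i s))"
proof -
  \<comment> \<open>The probability vectors on \<open>S\<close>. Coordinates outside
    \<open>S\<close> are pinned to 0, so that \<open>W\<close> is compact in the full function space
    by Tychonoff's theorem.\<close>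
  define W where "W = {w \<in> Pi UNIV (\<lambda>s. if s \<in> S then {0..1::real} else {0}). sum w S = 1}"
  define p where "p = (\<lambda>w i. \<Sum>s\<in>S. w s * X i s)"
  define q where "q = (\<lambda>w. \<Sum>i\<in>I. (p w i)\<^sup>2)"
  have cont: "continuous_on A (\<lambda>w. w s)" for A and s :: 's
    by (rule continuous_on_subset[OF continuous_on_product_coordinates subset_UNIV])
  have "closed {w :: 's \<Rightarrow> real. sum w S = 1}"
    by (intro closed_Collect_eq continuous_on_sum cont continuous_on_const)
  then have "compact W"
    unfolding W_def Collect_conj_eq Collect_mem_eq
    by (intro compact_Int_closed compact_box_fun) auto
  moreover obtain t0 where t0: "t0 \<in> S" using S by blast
  have "(\<lambda>s. if s = t0 then 1 else 0) \<in> W" using S t0 by (auto simp: W_def)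
  then have "W \<noteq> {}" by blast
  moreover have "continuous_on W q"
    unfolding q_def p_def by (intro continuous_on_sum continuous_on_power continuous_on_mult cont continuous_on_const)
  ultimately obtain w where w: "w \<in> W" and wmin: "\<And>w'. w' \<in> W \<Longrightarrow> q w \<le> q w'"
    using continuous_attains_inf by metis
  have ws: "w s \<in> (if s \<in> S then {0..1} else {0})" for s using w unfolding W_def Pi_iff by blast
  have w0: "0 \<le> w s" for s using ws[of s] by (auto split: if_splits)
  have wS: "w s = 0" if "s \<notin> S" for s using ws[of s] that by simp
  have w1: "sum w S = 1" using w by (simp add: W_def)
  obtain j where "j \<in> I" "p w j \<noteq> 0" using no[of w] w0 w1 unfolding p_def by auto
  then have qpos: "0 < q w" unfolding q_def using I by (intro sum_pos2[of _ j]) auto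
  \<comment> \<open>First-order condition at the minimiser: moving from \<open>w\<close> towards the
    vertex at \<open>t\<close> cannot decrease \<open>q\<close>, so the inner product of the
    least-norm point with the vector at \<open>t\<close> is at least its squared norm.\<close>
  have pt: "q w \<le> (\<Sum>i\<in>I. p w i * X i t)" if t: "t \<in> S" for t
  proof -
    define b where "b = (\<Sum>i\<in>I. p w i * (X i t - p w i))"
    define c where "c = (\<Sum>i\<in>I. (X i t - p w i)\<^sup>2)"
    have step: "0 \<le> 2 * b + e * c" if e: "0 < e" "e \<le> 1" for e
    proof -
      define v where "v = (\<lambda>s. (1 - e) * w s + (if s = t then e else 0))"
      have v1: "sum v S = 1"
        unfolding v_def using S t w1 by (simp add: sum.distrib sum_distrib_left[symmetric])
      have vnn: "0 \<le> v s" for s unfolding v_def using e w0 by simp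
      have "v s \<le> 1" if "s \<in> S" for s
        using member_le_sum[of s S v] that S vnn v1 by simp
      moreover have "v s = 0" if "s \<notin> S" for s using that wS t by (auto simp: v_def)
      ultimately have "v \<in> W" using v1 vnn by (auto simp: W_def)
      then have "q w \<le> q v" by (rule wmin)
      have pv: "p v i = p w i + e * (X i t - p w i)" for i
      proof -
        have "p v i = (\<Sum>s\<in>S. (1 - e) * (w s * X i s) + (if s = t then e * X i t else 0))"
          unfolding p_def v_def by (intro sum.cong) (auto simp: algebra_simps)
        also have "\<dots> = (1 - e) * p w i + e * X i t"
          using S t by (simp add: sum.distrib sum_distrib_left[symmetric] p_def)
        finally show ?thesis by (simp add: algebra_simps)
      qed
      have "q v = q w + e * (2 * b + e * c)"
        unfolding q_def pv b_def c_def
        by (simp add: sum.distrib sum_distrib_left power2_eq_square algebra_simps sum_subtractf)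
      with \<open>q w \<le> q v\<close> e show ?thesis by (simp add: zero_le_mult_iff)
    qed
    have "0 \<le> b"
    proof (rule ccontr)
      assume "\<not> 0 \<le> b"
      have c0: "0 \<le> c" unfolding c_def by (intro sum_nonneg) simp
      \<comment> \<open>If \<open>b\<close> is negative, a step this short makes
        \<open>2 * b + e * c\<close> negative. The denominator \<open>c + 1\<close> also covers
        \<open>c = 0\<close>.\<close>
      define e where "e = min 1 (- b / (c + 1))"
      have "b / (c + 1) < 0" using \<open>\<not> 0 \<le> b\<close> c0 by (intro divide_neg_pos) auto
      then have e: "0 < e" "e \<le> 1" "e \<le> - b / (c + 1)"
        by (auto simp: e_def)
      have "e * (c + 1) \<le> - b"
        using e(3) c0 by (subst pos_le_divide_eq[symmetric]) auto
      with step[OF e(1,2)] e(1) \<open>\<not> 0 \<le> b\<close> show False by (simp add: algebra_simps)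
    qed
    moreover have "b = (\<Sum>i\<in>I. p w i * X i t) - q w"
      by (simp add: b_def q_def power2_eq_square right_diff_distrib sum_subtractf)
    ultimately show ?thesis by simp
  qed
  \<comment> \<open>Scaled to the unit sphere, whose compactness serves the passage to infinite
    sets.\<close>
  let ?a = "\<lambda>i. p w i / sqrt (q w)"
  have "(\<Sum>i\<in>I. (?a i)\<^sup>2) = 1"
    using qpos by (simp add: power_divide sum_divide_distrib[symmetric]) (simp add: q_def)
  moreover have "0 \<le> (\<Sum>i\<in>I. ?a i * X i s)" if "s \<in> S" for s
  proof -
    have "(\<Sum>i\<in>I. ?a i * X i s) = (\<Sum>i\<in>I. p w i * X i s) / sqrt (q w)"
      by (simp add: sum_divide_distrib)
    then show ?thesis using pt[OF that] qpos by simp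
  qed
  ultimately show ?thesis by (intro exI[of _ ?a]) auto
qed

text \<open>The convex hull of an infinite set need not be closed, so there may be no point of least norm;
  instead, compactness of the unit sphere reduces the claim to finite subsets.\<close>

lemma gordan:
  fixes X :: "'i \<Rightarrow> 's \<Rightarrow> real"
  assumes I: "finite I" and A: "A \<noteq> {}"
    and no: "\<And>S w. finite S \<Longrightarrow> S \<subseteq> A \<Longrightarrow> (\<And>s. s \<in> S \<Longrightarrow> 0 \<le> w s) \<Longrightarrow> sum w S = 1 \<Longrightarrow>
               \<exists>i\<in>I. (\<Sum>s\<in>S. w s * X i s) \<noteq> 0"
  shows "\<exists>a. (\<exists>i\<in>I. a i \<noteq> 0) \<and> (\<forall>s\<in>A. 0 \<le> (\<Sum>i\<in>I. a i * X i s))"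
proof -
  \<comment> \<open>\<open>K\<close> is the unit sphere in the coordinates \<open>I\<close>, placed
    in a box to make it compact in the function space; \<open>H s\<close> below is the closed
    half-space of functionals nonnegative at \<open>s\<close>.\<close>
  define K where "K = {a \<in> Pi UNIV (\<lambda>i. if i \<in> I then {-1..1::real} else {0}). (\<Sum>i\<in>I. (a i)\<^sup>2) = 1}"
  define H where "H = (\<lambda>s. {a. 0 \<le> (\<Sum>i\<in>I. a i * X i s)})"
  have cont: "continuous_on B (\<lambda>a. a i)" for B and i :: 'i
    by (rule continuous_on_subset[OF continuous_on_product_coordinates subset_UNIV])
  have "closed {a :: 'i \<Rightarrow> real. (\<Sum>i\<in>I. (a i)\<^sup>2) = 1}"
    by (intro closed_Collect_eq continuous_on_sum continuous_on_power cont continuous_on_const)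
  then have "compact K"
    unfolding K_def Collect_conj_eq Collect_mem_eq
    by (intro compact_Int_closed compact_box_fun) auto
  moreover have "\<And>s. s \<in> A \<Longrightarrow> closed (H s)"
    unfolding H_def
    by (intro closed_Collect_le continuous_on_sum continuous_on_mult cont continuous_on_const)
  moreover have "\<And>S. finite S \<Longrightarrow> S \<subseteq> A \<Longrightarrow> K \<inter> (\<Inter>s\<in>S. H s) \<noteq> {}"
  proof -
    fix S assume S: "finite S" "S \<subseteq> A"
    \<comment> \<open>The finite intersection property includes \<open>S = {}\<close>, whereas
      \<open>finite_gordan\<close> asks for a nonempty set; hence the extra point.\<close>
    obtain s0 where "s0 \<in> A" using A by blast
    let ?S = "insert s0 S"
    have "\<exists>a. (\<Sum>i\<in>I. (a i)\<^sup>2) = 1 \<and> (\<forall>s\<in>?S. 0 \<le> (\<Sum>i\<in>I. a i * X i s))"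
      using S \<open>s0 \<in> A\<close> by (intro finite_gordan[OF I] no) auto
    then obtain a where a: "(\<Sum>i\<in>I. (a i)\<^sup>2) = 1" "\<forall>s\<in>?S. 0 \<le> (\<Sum>i\<in>I. a i * X i s)" by blast
    let ?a = "\<lambda>i. if i \<in> I then a i else 0"
    have "(a i)\<^sup>2 \<le> 1" if "i \<in> I" for i
      using member_le_sum[of i I "\<lambda>i. (a i)\<^sup>2"] that I a(1) by simp
    then have "a i \<in> {-1..1}" if "i \<in> I" for i using that by (simp add: abs_square_le_1 abs_le_iff)
    then have "?a \<in> K" unfolding K_def using a(1) by simp
    moreover have "?a \<in> H s" if "s \<in> S" for s using a(2) that by (simp add: H_def)
    ultimately show "K \<inter> (\<Inter>s\<in>S. H s) \<noteq> {}" by blast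
  qed
  ultimately have "K \<inter> (\<Inter>s\<in>A. H s) \<noteq> {}"
    by (rule compact_imp_fip_image)
  then obtain a where a: "(\<Sum>i\<in>I. (a i)\<^sup>2) = 1" "\<And>s. s \<in> A \<Longrightarrow> 0 \<le> (\<Sum>i\<in>I. a i * X i s)"
    unfolding K_def H_def by blast
  have "\<exists>i\<in>I. a i \<noteq> 0"
  proof (rule ccontr)
    assume "\<not> ?thesis"
    then have "(\<Sum>i\<in>I. (a i)\<^sup>2) = 0" by (simp add: sum.neutral)
    with a(1) show False by simp
  qed
  with a(2) show ?thesis by blast
qed

text \<open>If the origin were not in the hull, some nonzero functional would be nonnegative on
  \<open>A\<close>. Its mean is 0, so it vanishes almost everywhere, and the claim reduces to a
  hyperplane with one coordinate fewer. Letting \<open>A\<close> be any set of full measure makes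
  this induction possible, without closing the hull.\<close>

lemma (in prob_space) zero_mean_in_convex_hull:
  fixes X :: "'i \<Rightarrow> 'a \<Rightarrow> real"
  assumes "finite I" "\<And>i. i \<in> I \<Longrightarrow> integrable M (X i)" "\<And>i. i \<in> I \<Longrightarrow> expectation (X i) = 0"
    and "AE s in M. s \<in> A"
  shows "\<exists>S w. finite S \<and> S \<subseteq> A \<and> (\<forall>s\<in>S. 0 \<le> w s) \<and> sum w S = 1 \<and> (\<forall>i\<in>I. (\<Sum>s\<in>S. w s * X i s) = 0)"
  using assms
proof (induction I arbitrary: A rule: finite_psubset_induct)
  case (psubset I)
  show ?case
  proof (rule ccontr)
    assume no: "\<not> ?case"
    have "A \<noteq> {}"
    proof
      assume "A = {}"
      with psubset.prems(3) have "AE s in M. False" by simp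
      then show False by (simp only: AE_False)
    qed
    then have "\<exists>a. (\<exists>i\<in>I. a i \<noteq> 0) \<and> (\<forall>s\<in>A. 0 \<le> (\<Sum>i\<in>I. a i * X i s))"
      by (rule gordan[OF psubset.hyps(1)]) (use no in blast)
    then obtain a j where j: "j \<in> I" "a j \<noteq> 0" and a: "\<And>s. s \<in> A \<Longrightarrow> 0 \<le> (\<Sum>i\<in>I. a i * X i s)"
      by blast
    let ?Y = "\<lambda>s. \<Sum>i\<in>I. a i * X i s"
    have intY: "integrable M ?Y" using psubset.prems by (intro Bochner_Integration.integrable_sum) auto
    have "expectation ?Y = (\<Sum>i\<in>I. a i * expectation (X i))"
      using psubset.prems by (subst Bochner_Integration.integral_sum) auto
    then have "expectation ?Y = 0" using psubset.prems by simp
    moreover have "AE s in M. 0 \<le> ?Y s" using psubset.prems(3) a by auto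
    ultimately have "AE s in M. ?Y s = 0" using integral_nonneg_eq_0_iff_AE[OF intY] by blast
    \<comment> \<open>The part of \<open>A\<close> on the hyperplane still has full measure. There
      coordinate \<open>j\<close> is a linear combination of the others, so it can be left out of
      the induction and recovered afterwards.\<close>
    with psubset.prems(3) have "AE s in M. s \<in> A \<inter> {s. ?Y s = 0}" by auto
    then have "\<exists>S w. finite S \<and> S \<subseteq> A \<inter> {s. ?Y s = 0} \<and> (\<forall>s\<in>S. 0 \<le> w s) \<and> sum w S = 1 \<and>
        (\<forall>i\<in>I - {j}. (\<Sum>s\<in>S. w s * X i s) = 0)"
      using psubset.prems(1,2) j(1) by (intro psubset.IH) auto
    then obtain S w where S: "finite S" "S \<subseteq> A \<inter> {s. ?Y s = 0}" "\<forall>s\<in>S. 0 \<le> w s" "sum w S = 1"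
      "\<forall>i\<in>I - {j}. (\<Sum>s\<in>S. w s * X i s) = 0"
      by blast
    have "0 = (\<Sum>s\<in>S. w s * ?Y s)" using S(2) by (intro sum.neutral[symmetric]) auto
    also have "\<dots> = (\<Sum>i\<in>I. a i * (\<Sum>s\<in>S. w s * X i s))"
      unfolding sum_distrib_left by (subst sum.swap) (simp add: mult.left_commute)
    also have "\<dots> = a j * (\<Sum>s\<in>S. w s * X j s)"
      using S(5) psubset.hyps(1) j(1) by (subst sum.remove[of I j]) auto
    finally have "(\<Sum>s\<in>S. w s * X j s) = 0" using j(2) by simp
    with S have "?case" by (intro exI[of _ S] exI[of _ w]) auto
    with no show False by (rule notE)
  qed
qed

text \<open>Centring the \<open>X i\<close> reduces to mean zero and yields a finite convex
  combination, which \<open>conic_caratheodory\<close> then thins out. The weights need not sum to 1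
  any more unless the moments themselves force it.\<close>

lemma (in prob_space) finitely_supported_moments:
  fixes X :: "'i \<Rightarrow> 'a \<Rightarrow> real"
  assumes I: "finite I" and int: "\<And>i. i \<in> I \<Longrightarrow> integrable M (X i)"
  shows "\<exists>S w. finite S \<and> S \<subseteq> space M \<and> card S \<le> card I \<and> (\<forall>s\<in>S. 0 \<le> w s) \<and>
           (\<forall>i\<in>I. (\<Sum>s\<in>S. w s * X i s) = expectation (X i))"
proof -
  have "\<exists>S w. finite S \<and> S \<subseteq> space M \<and> (\<forall>s\<in>S. 0 \<le> w s) \<and> sum w S = 1 \<and>
          (\<forall>i\<in>I. (\<Sum>s\<in>S. w s * (X i s - expectation (X i))) = 0)"
    using int by (intro zero_mean_in_convex_hull[OF I]) (auto simp: prob_space)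
  then obtain S w where S: "finite S" "S \<subseteq> space M" "\<forall>s\<in>S. 0 \<le> w s" "sum w S = 1"
    "\<forall>i\<in>I. (\<Sum>s\<in>S. w s * (X i s - expectation (X i))) = 0" by blast
  then have mom: "\<forall>i\<in>I. (\<Sum>s\<in>S. w s * X i s) = expectation (X i)"
    by (simp add: right_diff_distrib sum_subtractf sum_distrib_right[symmetric])
  from conic_caratheodory[OF I S(1), of w X] S(3)
  obtain T v where T: "T \<subseteq> S" "card T \<le> card I" "\<forall>s\<in>T. 0 \<le> v s"
    "\<forall>i\<in>I. (\<Sum>s\<in>T. v s * X i s) = (\<Sum>s\<in>S. w s * X i s)" by auto
  with S mom finite_subset[OF T(1)] show ?thesis by (intro exI[of _ T] exI[of _ v]) auto
qed

subsection \<open>Replacing one factor of a product measure\<close>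

lemma indep_vars_PiM_coordinates:
  assumes "I \<noteq> {}" "\<And>i. i \<in> I \<Longrightarrow> prob_space (M i)"
  shows "prob_space.indep_vars (PiM I M) M (\<lambda>i \<omega>. \<omega> i) I"
proof -
  interpret prob_space "PiM I M" using assms(2) by (rule prob_space_PiM)
  have "distr (PiM I M) (PiM I M) (\<lambda>x. \<lambda>i\<in>I. x i) = distr (PiM I M) (PiM I M) (\<lambda>x. x)"
    by (intro distr_cong) (auto simp: space_PiM PiE_restrict)
  also have "\<dots> = PiM I (\<lambda>i. distr (PiM I M) (M i) (\<lambda>\<omega>. \<omega> i))"
    using assms(2) by (simp add: distr_PiM_component cong: PiM_cong)
  finally show ?thesis
    using assms(1) by (subst indep_vars_iff_distr_eq_PiM') auto
qed

text \<open>The restrictions of a random point to \<open>E\<close> and to \<open>- E\<close> are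
  independent, so it suffices to write each event as the preimage of a measurable set under the
  restriction on which it depends.\<close>

lemma measure_PiM_Int_disjoint_coordinates:
  fixes M :: "'i \<Rightarrow> 'a measure"
  assumes M: "\<And>i. prob_space (M i)"
    and A: "A \<in> sets (PiM UNIV M)" and B: "B \<in> sets (PiM UNIV M)"
    and depA: "\<And>u u'. u \<in> space (PiM UNIV M) \<Longrightarrow> u' \<in> space (PiM UNIV M) \<Longrightarrow>
                 \<forall>i\<in>E. u i = u' i \<Longrightarrow> u \<in> A \<Longrightarrow> u' \<in> A"
    and depB: "\<And>u u'. u \<in> space (PiM UNIV M) \<Longrightarrow> u' \<in> space (PiM UNIV M) \<Longrightarrow>
                 \<forall>i\<in>-E. u i = u' i \<Longrightarrow> u \<in> B \<Longrightarrow> u' \<in> B"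
  shows "measure (PiM UNIV M) (A \<inter> B) = measure (PiM UNIV M) A * measure (PiM UNIV M) B"
proof -
  interpret P: prob_space "PiM UNIV M" using M by (rule prob_space_PiM)
  obtain u0 where u0: "u0 \<in> space (PiM UNIV M)" using P.not_empty by blast
  have preimage: "\<exists>S'\<in>sets (PiM F M). S = (\<lambda>u. restrict u F) -` S' \<inter> space (PiM UNIV M)"
    if S: "S \<in> sets (PiM UNIV M)"
      and dep: "\<And>u u'. u \<in> space (PiM UNIV M) \<Longrightarrow> u' \<in> space (PiM UNIV M) \<Longrightarrow>
                 \<forall>i\<in>F. u i = u' i \<Longrightarrow> u \<in> S \<Longrightarrow> u' \<in> S" for S F
  proof -
    \<comment> \<open>Missing coordinates are filled in from the fixed point \<open>u0\<close>,
      which makes the required set a section of \<open>S\<close>, measurable like \<open>S\<close>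
      itself.\<close>
    let ?m = "\<lambda>x i. if i \<in> F then x i else u0 i"
    have m: "?m \<in> measurable (PiM F M) (PiM UNIV M)"
    proof (rule measurable_PiM_single')
      show "(\<lambda>x. ?m x i) \<in> measurable (PiM F M) (M i)" for i
        using u0 by (cases "i \<in> F") (auto simp: space_PiM PiE_iff)
    qed (use u0 in \<open>auto simp: space_PiM PiE_iff\<close>)
    have "S = (\<lambda>u. restrict u F) -` (?m -` S \<inter> space (PiM F M)) \<inter> space (PiM UNIV M)" (is "S = ?R")
    proof (rule set_eqI)
      fix u
      show "u \<in> S \<longleftrightarrow> u \<in> ?R"
      proof (cases "u \<in> space (PiM UNIV M)")
        case True
        have r: "restrict u F \<in> space (PiM F M)" using True by (auto simp: space_PiM)
        then have mr: "?m (restrict u F) \<in> space (PiM UNIV M)" using m by (rule measurable_space[rotated])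
        have "u \<in> S \<longleftrightarrow> ?m (restrict u F) \<in> S"
          using dep[OF True mr] dep[OF mr True] by auto
        with r True show ?thesis by auto
      next
        case False
        then show ?thesis using sets.sets_into_space[OF S] by auto
      qed
    qed
    with measurable_sets[OF m S] show ?thesis by blast
  qed
  obtain A' where A': "A' \<in> sets (PiM E M)" "A = (\<lambda>u. restrict u E) -` A' \<inter> space (PiM UNIV M)"
    by (rule bexE[OF preimage[of A E, OF A]]) (use depA in blast)+
  obtain B' where B': "B' \<in> sets (PiM (- E) M)" "B = (\<lambda>u. restrict u (- E)) -` B' \<inter> space (PiM UNIV M)"
    by (rule bexE[OF preimage[of B "- E", OF B]]) (use depB in blast)+
  have "P.indep_var (PiM E M) (\<lambda>\<omega>. restrict (\<lambda>i. \<omega> i) E) (PiM (- E) M) (\<lambda>\<omega>. restrict (\<lambda>i. \<omega> i) (- E))"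
    using M by (intro P.indep_var_restrict[OF indep_vars_PiM_coordinates]) auto
  from P.indep_varD[OF this A'(1) B'(1)] A'(2) B'(2) show ?thesis
    by (simp add: vimage_Times vimage_def Int_def conj_ac)
qed

section \<open>Slices of an event along one coordinate\<close>

lemma sets_PiM_update:
  "sets N = sets (M i) \<Longrightarrow> sets (PiM I (M(i := N))) = sets (PiM I M)"
  by (intro sets_PiM_cong) auto

text \<open>The conditional probability of \<open>A\<close> given that coordinate \<open>i\<close>
  equals \<open>s\<close>; as the coordinates are independent, conditioning is just fixing that
  coordinate.\<close>

definition slice_prob :: "('i \<Rightarrow> 'a measure) \<Rightarrow> 'i \<Rightarrow> ('i \<Rightarrow> 'a) set \<Rightarrow> 'a \<Rightarrow> real" where
  "slice_prob M i A s = measure (PiM (- {i}) M) {x \<in> space (PiM (- {i}) M). x(i := s) \<in> A}"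

lemma measurable_update_coordinate:
  fixes M :: "'i \<Rightarrow> 'a measure"
  shows "(\<lambda>(s, x). x(i := s)) \<in> measurable (M i \<Otimes>\<^sub>M PiM (- {i}) M) (PiM UNIV M)"
proof -
  let ?P = "M i \<Otimes>\<^sub>M PiM (- {i}) M"
  define f :: "'i \<Rightarrow> 'a \<times> ('i \<Rightarrow> 'a) \<Rightarrow> 'a"
    where "f = (\<lambda>j p. if j = i then fst p else snd p j)"
  have "f j \<in> measurable ?P (M j)" for j
  proof (cases "j = i")
    case True
    then show ?thesis by (simp add: f_def)
  next
    case False
    then have "(\<lambda>p. snd p j) \<in> measurable ?P (M j)"
      by (intro measurable_compose[OF measurable_snd measurable_component_singleton]) simp
    with False show ?thesis by (simp add: f_def)
  qed
  then have "(\<lambda>p. \<lambda>j\<in>UNIV. f j p) \<in> measurable ?P (PiM UNIV M)"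
    by (rule measurable_restrict)
  also have "(\<lambda>p. \<lambda>j\<in>UNIV. f j p) = (\<lambda>(s, x). x(i := s))"
    by (rule ext) (auto simp: f_def fun_eq_iff)
  finally show ?thesis .
qed

text \<open>Fubini's theorem with coordinate \<open>i\<close> split off. The integrand does not
  involve the law of coordinate \<open>i\<close>, so the same slice probabilities serve for every
  replacement \<open>N\<close>.\<close>

lemma
  fixes M :: "'i \<Rightarrow> 'a measure"
  assumes M: "\<And>i. prob_space (M i)" and A: "A \<in> sets (PiM UNIV M)"
  shows slice_prob_measurable: "slice_prob M i A \<in> borel_measurable (M i)"
    and slice_prob_bounds: "0 \<le> slice_prob M i A s" "slice_prob M i A s \<le> 1"
    and measure_PiM_update: "prob_space N \<Longrightarrow> sets N = sets (M i) \<Longrightarrow>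
           measure (PiM UNIV (M(i := N))) A = (\<integral>s. slice_prob M i A s \<partial>N)"
proof -
  interpret R: prob_space "PiM (- {i}) M" using M by (rule prob_space_PiM)
  show "0 \<le> slice_prob M i A s" "slice_prob M i A s \<le> 1" for s
    by (auto simp: slice_prob_def)
  let ?u = "\<lambda>(s, x). x(i := s)"
  let ?A = "?u -` A \<inter> space (M i \<Otimes>\<^sub>M PiM (- {i}) M)"
  have A': "?A \<in> sets (M i \<Otimes>\<^sub>M PiM (- {i}) M)"
    by (rule measurable_sets[OF measurable_update_coordinate A])
  have slice: "slice_prob M i A s = measure (PiM (- {i}) M) (Pair s -` ?A)" if "s \<in> space (M i)" for s
    unfolding slice_prob_def using that
    by (intro arg_cong[where f = "measure _"]) (auto simp: space_pair_measure)
  have "(\<lambda>s. measure (PiM (- {i}) M) (Pair s -` ?A)) \<in> borel_measurable (M i)"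
    unfolding measure_def
    by (intro borel_measurable_enn2real R.measurable_emeasure_Pair A')
  then show meas: "slice_prob M i A \<in> borel_measurable (M i)"
    by (rule measurable_cong[THEN iffD1, rotated]) (simp add: slice)
  assume N: "prob_space N" and sN: "sets N = sets (M i)"
  interpret N: prob_space N by fact
  have spN: "space N = space (M i)" using sN by (rule sets_eq_imp_space_eq)
  let ?M = "M(i := N)"
  have M': "prob_space (?M j)" for j using M N by simp
  interpret P: prob_space "PiM UNIV ?M" using M' by (rule prob_space_PiM)
  have eqR: "PiM (- {i}) ?M = PiM (- {i}) M" by (rule PiM_cong) auto
  have sets_pair: "sets (N \<Otimes>\<^sub>M PiM (- {i}) M) = sets (M i \<Otimes>\<^sub>M PiM (- {i}) M)"
    using sN by (rule sets_pair_measure_cong) simp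
  have sp_pair: "space (N \<Otimes>\<^sub>M PiM (- {i}) M) = space (M i \<Otimes>\<^sub>M PiM (- {i}) M)"
    using sets_pair by (rule sets_eq_imp_space_eq)
  have ins: "insert i (- {i}) = UNIV" by auto
  have "distr (N \<Otimes>\<^sub>M PiM (- {i}) M) (PiM UNIV ?M) ?u = PiM UNIV ?M"
    using distr_pair_PiM_eq_PiM[of "- {i}" ?M i] M' by (simp add: ins eqR del: fun_upd_apply) simp
  then have "emeasure (PiM UNIV ?M) A = emeasure (distr (N \<Otimes>\<^sub>M PiM (- {i}) M) (PiM UNIV ?M) ?u) A"
    by simp
  also have "\<dots> = emeasure (N \<Otimes>\<^sub>M PiM (- {i}) M) (?u -` A \<inter> space (N \<Otimes>\<^sub>M PiM (- {i}) M))"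
    using A measurable_update_coordinate[of i M]
    by (intro emeasure_distr)
       (simp_all add: sets_PiM_update[where M=M and i=i, OF sN] measurable_cong_sets[OF sets_pair sets_PiM_update[where M=M and i=i and I=UNIV, OF sN]])
  also have "\<dots> = (\<integral>\<^sup>+ s. emeasure (PiM (- {i}) M) (Pair s -` ?A) \<partial>N)"
    unfolding sp_pair using A' by (intro R.emeasure_pair_measure_alt) (simp add: sets_pair)
  also have "\<dots> = (\<integral>\<^sup>+ s. ennreal (slice_prob M i A s) \<partial>N)"
    by (intro nn_integral_cong) (simp add: slice spN R.emeasure_eq_measure)
  also have "\<dots> = ennreal (\<integral>s. slice_prob M i A s \<partial>N)"
    using meas \<open>\<And>s. 0 \<le> slice_prob M i A s\<close> \<open>\<And>s. slice_prob M i A s \<le> 1\<close>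
    by (intro nn_integral_eq_integral N.integrable_const_bound[where B = 1])
       (auto simp: measurable_cong_sets[OF sN refl])
  finally show "measure (PiM UNIV ?M) A = (\<integral>s. slice_prob M i A s \<partial>N)"
    using \<open>\<And>s. 0 \<le> slice_prob M i A s\<close>
    by (simp add: P.emeasure_eq_measure integral_nonneg_AE)
qed

text \<open>The slice probability is constant in the value of coordinate \<open>i\<close>, and every
  probability law integrates a constant to itself.\<close>

lemma measure_PiM_update_irrelevant:
  fixes M :: "'i \<Rightarrow> 'a measure"
  assumes M: "\<And>i. prob_space (M i)" and A: "A \<in> sets (PiM UNIV M)"
    and N: "prob_space N" "sets N = sets (M i)"
    and irr: "\<And>u s. u \<in> space (PiM UNIV M) \<Longrightarrow> s \<in> space (M i) \<Longrightarrow> u \<in> A \<Longrightarrow> u(i := s) \<in> A"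
  shows "measure (PiM UNIV (M(i := N))) A = measure (PiM UNIV M) A"
proof -
  obtain s0 where s0: "s0 \<in> space (M i)" using prob_space.not_empty[OF M] by blast
  have const: "slice_prob M i A s = slice_prob M i A s0" if s: "s \<in> space (M i)" for s
  proof -
    have "x(i := s') \<in> A" if "x \<in> space (PiM (- {i}) M)" "x(i := s'') \<in> A"
      "s' \<in> space (M i)" "s'' \<in> space (M i)" for x s' s''
    proof -
      have "x(i := s'') \<in> space (PiM UNIV M)" using sets.sets_into_space[OF A] that(2) by blast
      from irr[OF this that(3,2)] show ?thesis by simp
    qed
    then show ?thesis
      unfolding slice_prob_def using s s0
      by (intro arg_cong[where f = "measure _"] Collect_cong) blast
  qed
  have "(\<integral>s. slice_prob M i A s \<partial>L) = slice_prob M i A s0"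
    if "prob_space L" "sets L = sets (M i)" for L
  proof -
    interpret prob_space L by fact
    have "(\<integral>s. slice_prob M i A s \<partial>L) = (\<integral>s. slice_prob M i A s0 \<partial>L)"
      using const sets_eq_imp_space_eq[OF that(2)] by (intro Bochner_Integration.integral_cong) auto
    then show ?thesis by (simp add: prob_space)
  qed
  with measure_PiM_update[OF M A, of N i] measure_PiM_update[OF M A, of "M i" i] N M
  show ?thesis by simp
qed

text \<open>The vector of slice probabilities is averaged by \<^term>\<open>M i\<close>; Caratheodory's theorem
  replaces this average by one over at most \<^term>\<open>K\<close> points.\<close>

lemma discretize_coordinate:
  fixes M :: "'i \<Rightarrow> 'a measure" and A :: "'h \<Rightarrow> ('i \<Rightarrow> 'a) set"
  assumes M: "\<And>i. prob_space (M i)" and H: "finite H" "card H \<le> K"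
    and A: "\<And>h. h \<in> H \<Longrightarrow> A h \<in> sets (PiM UNIV M)"
    and disj: "disjoint_family_on A H" and cover: "(\<Union>h\<in>H. A h) = space (PiM UNIV M)"
  shows "\<exists>(N :: nat measure) e. prob_space N \<and> sets N = Pow {..<K} \<and> e \<in> measurable N (M i) \<and>
           (\<forall>h\<in>H. measure (PiM UNIV (M(i := distr N (M i) e))) (A h) = measure (PiM UNIV M) (A h))"
proof -
  interpret Mi: prob_space "M i" by (rule M)
  interpret R: prob_space "PiM (- {i}) M" using M by (rule prob_space_PiM)
  interpret P: prob_space "PiM UNIV M" using M by (rule prob_space_PiM)
  let ?X = "\<lambda>h. slice_prob M i (A h)"
  note meas = slice_prob_measurable[OF M A] and bounds = slice_prob_bounds[OF M A]
  have int: "integrable (M i) (?X h)" if "h \<in> H" for h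
    using that meas bounds by (intro Mi.integrable_const_bound[where B = 1]) auto
  have E: "Mi.expectation (?X h) = measure (PiM UNIV M) (A h)" if "h \<in> H" for h
    using measure_PiM_update[OF M A[OF that], of "M i" i] M by simp
  have sum1: "(\<Sum>h\<in>H. ?X h s) = 1" if s: "s \<in> space (M i)" for s
  proof -
    let ?B = "\<lambda>h. {x \<in> space (PiM (- {i}) M). x(i := s) \<in> A h}"
    have u: "(\<lambda>x. x(i := s)) \<in> measurable (PiM (- {i}) M) (PiM UNIV M)"
      using measurable_compose[OF measurable_Pair1'[OF s] measurable_update_coordinate[of i M]] by simp
    have B: "?B h \<in> sets (PiM (- {i}) M)" if "h \<in> H" for h
      using measurable_sets[OF u A[OF that]] by (simp add: vimage_def Int_def conj_commute)
    have "(\<Sum>h\<in>H. ?X h s) = measure (PiM (- {i}) M) (\<Union>h\<in>H. ?B h)"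
      unfolding slice_prob_def using B disj H
      by (intro R.finite_measure_finite_Union[symmetric]) (auto simp: disjoint_family_on_def)
    also have "(\<Union>h\<in>H. ?B h) = space (PiM (- {i}) M)"
      using measurable_space[OF u] cover by blast
    finally show ?thesis by (simp add: R.prob_space)
  qed
  obtain S w where S: "finite S" "S \<subseteq> space (M i)" "card S \<le> card H" "\<forall>s\<in>S. 0 \<le> w s"
    and mom: "\<forall>h\<in>H. (\<Sum>s\<in>S. w s * ?X h s) = Mi.expectation (?X h)"
    using Mi.finitely_supported_moments[OF H(1), of ?X] int by auto
  \<comment> \<open>The thinned weights are not normalised by construction. They sum to 1 because
    the events partition the space: the slice probabilities sum to 1 at each point, and so do their
    means.\<close>
  have "sum w S = (\<Sum>s\<in>S. w s * (\<Sum>h\<in>H. ?X h s))"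
    using S(2) sum1 by (intro sum.cong) auto
  also have "\<dots> = (\<Sum>h\<in>H. \<Sum>s\<in>S. w s * ?X h s)"
    unfolding sum_distrib_left by (rule sum.swap)
  also have "\<dots> = (\<Sum>h\<in>H. measure (PiM UNIV M) (A h))" using mom E by simp
  also have "\<dots> = 1"
    using P.finite_measure_finite_Union[OF H(1) _ disj] A cover by (auto simp: P.prob_space)
  finally have w1: "sum w S = 1" .
  obtain g where g: "bij_betw g {..<card S} S"
    using ex_bij_betw_nat_finite[OF S(1)] by (auto simp: atLeast0LessThan)
  obtain s0 where s0: "s0 \<in> space (M i)" using Mi.not_empty by blast
  \<comment> \<open>Exactly \<open>K\<close> labels are wanted although the support may be smaller:
    surplus labels get weight 0 and are sent to an arbitrary point \<open>s0\<close>.\<close>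
  define p where "p = (\<lambda>n. if n < card S then w (g n) else 0)"
  define e where "e = (\<lambda>n. if n < card S then g n else s0)"
  define N where "N = point_measure {..<K} p"
  have gS: "g n \<in> S" if "n < card S" for n using g that by (auto simp: bij_betw_def)
  have p0: "0 \<le> p n" for n using S(4) gS by (simp add: p_def)
  have psum: "(\<Sum>n<K. p n * F (e n)) = (\<Sum>s\<in>S. w s * F s)" for F
  proof -
    have "(\<Sum>n<K. p n * F (e n)) = (\<Sum>n<card S. p n * F (e n))"
      using S(3) H(2) by (intro sum.mono_neutral_right) (auto simp: p_def)
    also have "\<dots> = (\<Sum>n<card S. w (g n) * F (g n))" by (simp add: p_def e_def)
    also have "\<dots> = (\<Sum>s\<in>S. w s * F s)" by (rule sum.reindex_bij_betw[OF g])
    finally show ?thesis .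
  qed
  have N: "prob_space N"
    unfolding N_def using psum[of "\<lambda>_. 1"] w1 p0 by (intro prob_space_point_measure) auto
  have sN: "sets N = Pow {..<K}" by (simp add: N_def sets_point_measure)
  have es: "e n \<in> space (M i)" for n
    using gS[of n] S(2) s0 by (auto simp: e_def)
  have eN: "e \<in> measurable N (M i)"
    using es unfolding N_def measurable_point_measure_eq1 by auto
  have D: "prob_space (distr N (M i) e)" using N eN by (rule prob_space.prob_space_distr)
  have "measure (PiM UNIV (M(i := distr N (M i) e))) (A h) = measure (PiM UNIV M) (A h)" if h: "h \<in> H" for h
  proof -
    have "measure (PiM UNIV (M(i := distr N (M i) e))) (A h) = (\<integral>s. ?X h s \<partial>distr N (M i) e)"
      using D by (intro measure_PiM_update[OF M A[OF h]]) auto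
    also have "\<dots> = (\<integral>n. ?X h (e n) \<partial>N)" by (rule integral_distr[OF eN meas[OF h]])
    also have "\<dots> = (\<Sum>n<K. p n * ?X h (e n))"
      unfolding N_def using p0 by (subst lebesgue_integral_point_measure_finite) auto
    also have "\<dots> = measure (PiM UNIV M) (A h)" using psum mom E h by simp
    finally show ?thesis .
  qed
  with N sN eN show ?thesis by blast
qed

subsection \<open>Canonical structural causal models\<close>

text \<open>Extensional functions are used so that a tuple is determined by its values on
  realizations in \<open>\<Omega>\<close> and the tuples of a c-component are counted by
  \<open>canon_card\<close>.\<close>

abbreviation response_functions ::
  "('v \<Rightarrow> 'v set) \<Rightarrow> ('v \<Rightarrow> 'd set) \<Rightarrow> 'v set \<Rightarrow> ('v \<Rightarrow> ('v \<Rightarrow> 'd) \<Rightarrow> 'd) set" where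
  "response_functions pa \<Omega> C \<equiv> PiE C (\<lambda>V. PiE (PiE (pa V) \<Omega>) (\<lambda>_. \<Omega> V))"

text \<open>Agreement with \<open>h\<close> is tested only at parent realizations inside
  \<open>\<Omega>\<close>. For finite domains these are finitely many, which makes the event
  measurable.\<close>

definition response_event ::
  "('v \<Rightarrow> 'v set) \<Rightarrow> ('v \<Rightarrow> 'd set) \<Rightarrow> ('u \<Rightarrow> 'e measure) \<Rightarrow> ('v \<Rightarrow> ('v \<Rightarrow> 'd) \<Rightarrow> ('u \<Rightarrow> 'e) \<Rightarrow> 'd)
   \<Rightarrow> 'v set \<Rightarrow> ('v \<Rightarrow> ('v \<Rightarrow> 'd) \<Rightarrow> 'd) \<Rightarrow> ('u \<Rightarrow> 'e) set" where
  "response_event pa \<Omega> \<mu> f C h =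
     {u \<in> space (PiM UNIV \<mu>). \<forall>V\<in>C. \<forall>w\<in>PiE (pa V) \<Omega>. f V w u = h V w}"

section \<open>Response events as a finite measurable partition\<close>

lemma finite_realizations:
  fixes pa :: "'v::finite \<Rightarrow> 'v set"
  assumes "\<forall>V. finite (\<Omega> V)"
  shows "finite (PiE (pa V) \<Omega>)"
  using assms by (intro finite_PiE) auto

lemma finite_response_functions:
  fixes pa :: "'v::finite \<Rightarrow> 'v set"
  assumes "\<forall>V. finite (\<Omega> V)"
  shows "finite (response_functions pa \<Omega> C)"
  using assms finite_realizations[OF assms] by (intro finite_PiE) auto

lemma canon_card_eq_card:
  fixes pa :: "'v::finite \<Rightarrow> 'v set"
  shows "canon_card pa ex \<Omega> U = card (response_functions pa \<Omega> (c_comp ex U))"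
  by (simp add: canon_card_def card_PiE)

lemma compatible_scmD:
  assumes "compatible_scm pa ex \<Omega> \<mu> f"
  shows "prob_space (\<mu> U)" "(\<lambda>u. f V w u) \<in> measurable (PiM UNIV \<mu>) (count_space UNIV)"
    "u \<in> space (PiM UNIV \<mu>) \<Longrightarrow> f V w u \<in> \<Omega> V"
    "\<forall>W\<in>pa V. w W = w' W \<Longrightarrow> \<forall>U\<in>ex V. u U = u' U \<Longrightarrow> f V w u = f V w' u'"
  using assms unfolding compatible_scm_def by blast+

text \<open>Apart from being probabilities, the laws enter compatibility only through their
  sigma-algebras; hence \<open>f\<close> can be kept while the laws are exchanged.\<close>

lemma compatible_scm_cong_sets:
  assumes "compatible_scm pa ex \<Omega> \<mu> f" "\<And>U. prob_space (\<nu> U)" "\<And>U. sets (\<nu> U) = sets (\<mu> U)"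
  shows "compatible_scm pa ex \<Omega> \<nu> f"
proof -
  have s: "sets (PiM UNIV \<nu>) = sets (PiM UNIV \<mu>)" using assms(3) by (intro sets_PiM_cong) auto
  show ?thesis
    using assms(1,2) unfolding compatible_scm_def measurable_cong_sets[OF s refl] sets_eq_imp_space_eq[OF s]
    by blast
qed

lemma response_event_cong_sets:
  assumes "\<And>U. sets (\<nu> U) = sets (\<mu> U)"
  shows "response_event pa \<Omega> \<nu> f C h = response_event pa \<Omega> \<mu> f C h"
proof -
  have "space (PiM UNIV \<nu>) = space (PiM UNIV \<mu>)"
    using assms by (intro sets_eq_imp_space_eq sets_PiM_cong) auto
  then show ?thesis by (simp add: response_event_def)
qed

lemma response_event_sets:
  fixes pa :: "'v::finite \<Rightarrow> 'v set"
  assumes f: "compatible_scm pa ex \<Omega> \<mu> f" and \<Omega>: "\<forall>V. finite (\<Omega> V)"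
  shows "response_event pa \<Omega> \<mu> f C h \<in> sets (PiM UNIV \<mu>)"
proof -
  have "{u \<in> space (PiM UNIV \<mu>). f V w u = h V w} \<in> sets (PiM UNIV \<mu>)" for V w
    using measurable_sets[OF compatible_scmD(2)[OF f, of V w], of "{h V w}"]
    by (simp add: vimage_def Int_def conj_commute)
  then show ?thesis
    unfolding response_event_def
    by (intro sets.sets_Collect_finite_All finite_realizations[OF \<Omega>] finite_class.finite)
qed

lemma response_event_restrict:
  "response_event pa \<Omega> \<mu> f C (restrict h C) = response_event pa \<Omega> \<mu> f C h"
  by (simp add: response_event_def)

lemma response_event_split:
  "response_event pa \<Omega> \<mu> f UNIV h = response_event pa \<Omega> \<mu> f C h \<inter> response_event pa \<Omega> \<mu> f (- C) h"
  by (auto simp: response_event_def)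

lemma disjoint_response_events:
  "disjoint_family_on (response_event pa \<Omega> \<mu> f C) (response_functions pa \<Omega> C)"
proof -
  have eq: "h = h'" if h: "h \<in> response_functions pa \<Omega> C" "h' \<in> response_functions pa \<Omega> C"
    and u: "u \<in> response_event pa \<Omega> \<mu> f C h" "u \<in> response_event pa \<Omega> \<mu> f C h'" for h h' u
  proof (rule PiE_ext[OF h])
    fix V assume V: "V \<in> C"
    show "h V = h' V"
      by (rule PiE_ext[OF PiE_mem[OF h(1) V] PiE_mem[OF h(2) V]])
         (use u V in \<open>auto simp: response_event_def\<close>)
  qed
  show ?thesis
    unfolding disjoint_family_on_def
  proof (intro ballI impI equals0I)
    fix h h' u
    assume h: "h \<in> response_functions pa \<Omega> C" "h' \<in> response_functions pa \<Omega> C" "h \<noteq> h'"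
      and "u \<in> response_event pa \<Omega> \<mu> f C h \<inter> response_event pa \<Omega> \<mu> f C h'"
    with eq[OF h(1,2)] show False by blast
  qed
qed

lemma response_functions_cover:
  assumes f: "compatible_scm pa ex \<Omega> \<mu> f" and u: "u \<in> space (PiM UNIV \<mu>)"
  shows "\<exists>h\<in>response_functions pa \<Omega> C. u \<in> response_event pa \<Omega> \<mu> f C h"
proof
  let ?h = "\<lambda>V\<in>C. \<lambda>w\<in>PiE (pa V) \<Omega>. f V w u"
  show "?h \<in> response_functions pa \<Omega> C" using compatible_scmD(3)[OF f u] by auto
  show "u \<in> response_event pa \<Omega> \<mu> f C ?h" using u by (simp add: response_event_def)
qed

lemma response_event_dep:
  assumes f: "compatible_scm pa ex \<Omega> \<mu> f"
    and u: "u \<in> response_event pa \<Omega> \<mu> f C h" "u' \<in> space (PiM UNIV \<mu>)"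
    and eq: "\<And>V U. V \<in> C \<Longrightarrow> U \<in> ex V \<Longrightarrow> u U = u' U"
  shows "u' \<in> response_event pa \<Omega> \<mu> f C h"
proof -
  have "f V w u' = f V w u" if "V \<in> C" for V w
    by (rule compatible_scmD(4)[OF f]) (use eq[OF that] in auto)
  then show ?thesis using u by (auto simp: response_event_def)
qed

section \<open>C-components and the replacement of exogenous laws\<close>

lemma c_comp_self: "U \<in> ex V \<Longrightarrow> V \<in> c_comp ex U"
  by (auto simp: c_comp_def)

text \<open>\<open>V\<close> is itself a common child of \<open>U'\<close> and of the exogenous
  parent through which \<open>V\<close> was reached, so the chain from \<open>U\<close> extends by
  one link.\<close>

lemma ex_in_component:
  assumes "V \<in> c_comp ex U" "U' \<in> ex V"
  shows "(U, U') \<in> (share_child ex)\<^sup>*"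
proof -
  from assms(1) obtain W where W: "(U, W) \<in> (share_child ex)\<^sup>*" "W \<in> ex V" by (auto simp: c_comp_def)
  with assms(2) have "(W, U') \<in> share_child ex" by (auto simp: share_child_def)
  with W(1) show ?thesis by (rule rtrancl_into_rtrancl)
qed

text \<open>The responses inside the c-component of \<^term>\<open>U\<close> are independent of those outside,
  which do not see \<^term>\<open>U\<close>; so only the law of the former has to be reproduced.\<close>

lemma discretize_exogenous:
  fixes pa :: "'v::finite \<Rightarrow> 'v set" and \<mu> :: "'u \<Rightarrow> 'e measure"
  assumes f: "compatible_scm pa ex \<Omega> \<mu> f" and \<Omega>: "\<forall>V. finite (\<Omega> V)"
  shows "\<exists>(N :: nat measure) e. prob_space N \<and> sets N = Pow {..<canon_card pa ex \<Omega> U} \<and>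
           e \<in> measurable N (\<mu> U) \<and>
           (\<forall>h\<in>response_functions pa \<Omega> UNIV.
              measure (PiM UNIV (\<mu>(U := distr N (\<mu> U) e))) (response_event pa \<Omega> \<mu> f UNIV h) =
              measure (PiM UNIV \<mu>) (response_event pa \<Omega> \<mu> f UNIV h))"
proof -
  let ?C = "c_comp ex U" and ?E = "{U'. (U, U') \<in> (share_child ex)\<^sup>*}"
  let ?A = "response_event pa \<Omega> \<mu> f"
  note P = compatible_scmD(1)[OF f]
  note S = response_event_sets[OF f \<Omega>]
  have "(\<Union>h\<in>response_functions pa \<Omega> ?C. ?A ?C h) = space (PiM UNIV \<mu>)"
    using response_functions_cover[OF f, of _ ?C] by (auto simp: response_event_def)
  from discretize_coordinate[OF P finite_response_functions[OF \<Omega>] _ S disjoint_response_events this,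
      of "canon_card pa ex \<Omega> U" U]
  obtain N :: "nat measure" and e where N: "prob_space N" "sets N = Pow {..<canon_card pa ex \<Omega> U}"
    "e \<in> measurable N (\<mu> U)"
    and eqC: "\<And>h. h \<in> response_functions pa \<Omega> ?C \<Longrightarrow>
      measure (PiM UNIV (\<mu>(U := distr N (\<mu> U) e))) (?A ?C h) = measure (PiM UNIV \<mu>) (?A ?C h)"
    by (auto simp: canon_card_eq_card)
  let ?D = "distr N (\<mu> U) e"
  let ?\<mu> = "\<mu>(U := ?D)"
  have D: "prob_space ?D" "sets ?D = sets (\<mu> U)"
    using N prob_space.prob_space_distr by auto
  have P': "prob_space (?\<mu> U')" and sets': "sets (?\<mu> U') = sets (\<mu> U')" for U' using P D by auto
  have f': "compatible_scm pa ex \<Omega> ?\<mu> f" by (rule compatible_scm_cong_sets[OF f P' sets'])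
  have ev': "response_event pa \<Omega> ?\<mu> f C h = ?A C h" for C h
    by (rule response_event_cong_sets[OF sets'])
  \<comment> \<open>Stated for an arbitrary law \<open>\<nu>\<close>, since it is applied both
    before and after the replacement. No node has exogenous parents both inside and outside
    \<open>?E\<close>: in \<open>?C\<close> all of them are linked to \<open>U\<close>, outside
    \<open>?C\<close> none is.\<close>
  have factor: "measure (PiM UNIV \<nu>) (response_event pa \<Omega> \<nu> f UNIV h) =
      measure (PiM UNIV \<nu>) (response_event pa \<Omega> \<nu> f ?C h) *
      measure (PiM UNIV \<nu>) (response_event pa \<Omega> \<nu> f (- ?C) h)"
    if g: "compatible_scm pa ex \<Omega> \<nu> f" for \<nu> :: "'u \<Rightarrow> 'e measure" and h
    unfolding response_event_split[of pa \<Omega> \<nu> f h ?C]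
  proof (rule measure_PiM_Int_disjoint_coordinates[where E = ?E])
    show "prob_space (\<nu> i)" for i using g by (rule compatible_scmD)
    show "response_event pa \<Omega> \<nu> f ?C h \<in> sets (PiM UNIV \<nu>)"
      "response_event pa \<Omega> \<nu> f (- ?C) h \<in> sets (PiM UNIV \<nu>)"
      by (rule response_event_sets[OF g \<Omega>])+
  next
    fix u u' assume u: "u' \<in> space (PiM UNIV \<nu>)" "\<forall>i\<in>?E. u i = u' i" "u \<in> response_event pa \<Omega> \<nu> f ?C h"
    show "u' \<in> response_event pa \<Omega> \<nu> f ?C h"
    proof (rule response_event_dep[OF g u(3,1)])
      fix V U' assume "V \<in> ?C" "U' \<in> ex V"
      then have "U' \<in> ?E" using ex_in_component[of V ex U U'] by simp
      with u(2) show "u U' = u' U'" by (rule bspec)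
    qed
  next
    fix u u' assume u: "u' \<in> space (PiM UNIV \<nu>)" "\<forall>i\<in>- ?E. u i = u' i"
      "u \<in> response_event pa \<Omega> \<nu> f (- ?C) h"
    show "u' \<in> response_event pa \<Omega> \<nu> f (- ?C) h"
    proof (rule response_event_dep[OF g u(3,1)])
      fix V U' assume "V \<in> - ?C" "U' \<in> ex V"
      then have "U' \<in> - ?E" by (auto simp: c_comp_def)
      with u(2) show "u U' = u' U'" by (rule bspec)
    qed
  qed
  have eqC': "measure (PiM UNIV ?\<mu>) (?A ?C h) = measure (PiM UNIV \<mu>) (?A ?C h)"
    if "h \<in> response_functions pa \<Omega> UNIV" for h
  proof -
    have "restrict h ?C \<in> response_functions pa \<Omega> ?C" using that by (auto simp: PiE_iff)
    from eqC[OF this] show ?thesis by (simp only: response_event_restrict)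
  qed
  have eqD: "measure (PiM UNIV ?\<mu>) (?A (- ?C) h) = measure (PiM UNIV \<mu>) (?A (- ?C) h)" for h
  proof (rule measure_PiM_update_irrelevant[OF P S D])
    fix u s assume u: "u \<in> space (PiM UNIV \<mu>)" "s \<in> space (\<mu> U)" "u \<in> ?A (- ?C) h"
    have "u(U := s) \<in> space (PiM UNIV \<mu>)" using u(1,2) by (auto simp: space_PiM PiE_UNIV_domain Pi_iff)
    then show "u(U := s) \<in> ?A (- ?C) h"
      by (rule response_event_dep[OF f u(3)]) (auto dest: c_comp_self)
  qed
  have "measure (PiM UNIV ?\<mu>) (?A UNIV h) = measure (PiM UNIV \<mu>) (?A UNIV h)"
    if "h \<in> response_functions pa \<Omega> UNIV" for h
    using factor[OF f', of h, unfolded ev'] factor[OF f, of h] eqC'[OF that] eqD[of h] by simp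
  with N show ?thesis by blast
qed

text \<open>The variables of \<open>F\<close> are treated one at a time. Each discrete law is pushed
  forward to the original space by \<open>e U\<close>, so \<open>f\<close> and the response events
  stay the same throughout the induction.\<close>

lemma discretize_exogenous_set:
  fixes pa :: "'v::finite \<Rightarrow> 'v set" and \<mu> :: "'u \<Rightarrow> 'e measure"
  assumes f: "compatible_scm pa ex \<Omega> \<mu> f" and \<Omega>: "\<forall>V. finite (\<Omega> V)" and "finite F"
  shows "\<exists>(\<nu> :: 'u \<Rightarrow> nat measure) e.
           (\<forall>U\<in>F. prob_space (\<nu> U) \<and> sets (\<nu> U) = Pow {..<canon_card pa ex \<Omega> U} \<and>
              e U \<in> measurable (\<nu> U) (\<mu> U)) \<and>
           (\<forall>h\<in>response_functions pa \<Omega> UNIV.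
              measure (PiM UNIV (\<lambda>U. if U \<in> F then distr (\<nu> U) (\<mu> U) (e U) else \<mu> U))
                (response_event pa \<Omega> \<mu> f UNIV h) =
              measure (PiM UNIV \<mu>) (response_event pa \<Omega> \<mu> f UNIV h))"
  using assms(3)
proof (induction F rule: finite_induct)
  case empty
  then show ?case by simp
next
  case (insert U F)
  then obtain \<nu> :: "'u \<Rightarrow> nat measure" and e where
    \<nu>: "\<forall>U\<in>F. prob_space (\<nu> U) \<and> sets (\<nu> U) = Pow {..<canon_card pa ex \<Omega> U} \<and>
              e U \<in> measurable (\<nu> U) (\<mu> U)"
    and eq: "\<forall>h\<in>response_functions pa \<Omega> UNIV.
        measure (PiM UNIV (\<lambda>U. if U \<in> F then distr (\<nu> U) (\<mu> U) (e U) else \<mu> U))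
          (response_event pa \<Omega> \<mu> f UNIV h) =
        measure (PiM UNIV \<mu>) (response_event pa \<Omega> \<mu> f UNIV h)"
    by blast
  let ?\<mu> = "\<lambda>U. if U \<in> F then distr (\<nu> U) (\<mu> U) (e U) else \<mu> U"
  have sets': "sets (?\<mu> U') = sets (\<mu> U')" for U' by simp
  have P': "prob_space (?\<mu> U')" for U'
    using \<nu> compatible_scmD(1)[OF f] by (auto intro: prob_space.prob_space_distr)
  have U: "?\<mu> U = \<mu> U" using insert by simp
  from discretize_exogenous[OF compatible_scm_cong_sets[OF f P' sets'] \<Omega>, of U]
  obtain N :: "nat measure" and g where N: "prob_space N" "sets N = Pow {..<canon_card pa ex \<Omega> U}"
    "g \<in> measurable N (\<mu> U)"
    and step: "\<forall>h\<in>response_functions pa \<Omega> UNIV.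
       measure (PiM UNIV (?\<mu>(U := distr N (\<mu> U) g))) (response_event pa \<Omega> \<mu> f UNIV h) =
       measure (PiM UNIV ?\<mu>) (response_event pa \<Omega> \<mu> f UNIV h)"
    unfolding U response_event_cong_sets[OF sets'] by blast
  let ?\<nu> = "\<nu>(U := N)" and ?e = "e(U := g)"
  have upd: "(\<lambda>V. if V \<in> insert U F then distr (?\<nu> V) (\<mu> V) (?e V) else \<mu> V) = ?\<mu>(U := distr N (\<mu> U) g)"
    by (auto simp: fun_eq_iff)
  show ?case
  proof (intro exI[of _ ?\<nu>] exI[of _ ?e] conjI)
    show "\<forall>V\<in>insert U F. prob_space (?\<nu> V) \<and> sets (?\<nu> V) = Pow {..<canon_card pa ex \<Omega> V} \<and>
              ?e V \<in> measurable (?\<nu> V) (\<mu> V)"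
      using \<nu> N by simp
  qed (unfold upd, use step eq in simp)
qed

section \<open>Counterfactual events in terms of response functions\<close>

lemma resp_cong:
  assumes f: "compatible_scm pa ex \<Omega> \<mu> f" and x: "realization \<Omega> x"
    and u: "u \<in> space (PiM UNIV \<mu>)" "u' \<in> space (PiM UNIV \<mu>)"
    and eq: "\<And>V w. w \<in> PiE (pa V) \<Omega> \<Longrightarrow> f V w u = f V w u'"
  shows "resp f x u = resp f x u'"
proof -
  \<comment> \<open>\<open>resp\<close> is a definite description, so it suffices that both
    submodels have the same solutions; solutions take values in \<open>\<Omega>\<close>, where the
    structural functions agree.\<close>
  let ?sol = "\<lambda>v u. \<forall>V. v V = (case x V of Some c \<Rightarrow> c | None \<Rightarrow> f V v u)"
  have f_eq: "f V v u = f V v u'" if v: "\<And>W. v W \<in> \<Omega> W" for V v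
  proof -
    \<comment> \<open>The hypothesis speaks of extensional parent realizations only, so
      \<open>v\<close> is first cut down to \<open>pa V\<close>.\<close>
    have "f V v u'' = f V (restrict v (pa V)) u''" for u''
      by (rule compatible_scmD(4)[OF f]) auto
    moreover have "restrict v (pa V) \<in> PiE (pa V) \<Omega>" using v by auto
    ultimately show ?thesis using eq by metis
  qed
  have in_\<Omega>: "v W \<in> \<Omega> W" if "?sol v u''" "u'' \<in> space (PiM UNIV \<mu>)" for v u'' W
    using that(1)[rule_format, of W] x compatible_scmD(3)[OF f that(2)]
    by (auto simp: realization_def split: option.splits)
  have "?sol v u \<longleftrightarrow> ?sol v u'" for v
  proof
    assume sol: "?sol v u"
    have "f V v u = f V v u'" for V by (rule f_eq[OF in_\<Omega>[OF sol u(1)]])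
    from sol[unfolded this] show "?sol v u'" .
  next
    assume sol: "?sol v u'"
    have "f V v u' = f V v u" for V by (rule f_eq[OF in_\<Omega>[OF sol u(2)], symmetric])
    from sol[unfolded this] show "?sol v u" .
  qed
  then show ?thesis unfolding resp_def by simp
qed

text \<open>A response event fixes all potential responses, so a counterfactual event holds on all
  of it or nowhere on it. This gives both its measurability and its probability as a finite sum over
  \<open>G\<close>.\<close>

lemma cf_event_decomposition:
  fixes pa :: "'v::finite \<Rightarrow> 'v set"
  assumes f: "compatible_scm pa ex \<Omega> \<mu> f" and evs: "\<forall>(x, y)\<in>set evs. realization \<Omega> x"
  shows "\<exists>G\<subseteq>response_functions pa \<Omega> UNIV.
           {u \<in> space (PiM UNIV \<mu>). cf_holds f evs u} = (\<Union>h\<in>G. response_event pa \<Omega> \<mu> f UNIV h)"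
proof -
  let ?H = "response_functions pa \<Omega> UNIV" and ?A = "response_event pa \<Omega> \<mu> f UNIV"
  let ?G = "{h \<in> ?H. \<exists>u\<in>?A h. cf_holds f evs u}"
  have cf_eq: "cf_holds f evs u'" if "cf_holds f evs u" "u \<in> ?A h" "u' \<in> ?A h" for u u' h
  proof -
    have resp_eq: "resp f x u = resp f x u'" if "realization \<Omega> x" for x
      by (rule resp_cong[OF f that]) (use \<open>u \<in> ?A h\<close> \<open>u' \<in> ?A h\<close> in \<open>auto simp: response_event_def\<close>)
    have "y V = Some (resp f x u' V)" if xy: "(x, y) \<in> set evs" and V: "V \<in> dom y" for x y V
    proof -
      have "realization \<Omega> x" using evs xy by blast
      moreover have "y V = Some (resp f x u V)"
        using \<open>cf_holds f evs u\<close> xy V unfolding cf_holds_def by blast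
      ultimately show ?thesis by (simp only: resp_eq)
    qed
    then show ?thesis unfolding cf_holds_def by blast
  qed
  have "{u \<in> space (PiM UNIV \<mu>). cf_holds f evs u} = (\<Union>h\<in>?G. ?A h)"
  proof (intro set_eqI iffI)
    fix u assume "u \<in> {u \<in> space (PiM UNIV \<mu>). cf_holds f evs u}"
    then show "u \<in> (\<Union>h\<in>?G. ?A h)" using response_functions_cover[OF f, of u UNIV] by blast
  next
    fix u assume "u \<in> (\<Union>h\<in>?G. ?A h)"
    then obtain h u' where "u \<in> ?A h" "u' \<in> ?A h" "cf_holds f evs u'" by blast
    with cf_eq show "u \<in> {u \<in> space (PiM UNIV \<mu>). cf_holds f evs u}"
      by (auto simp: response_event_def)
  qed
  then show ?thesis by (intro exI[of _ ?G]) auto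
qed

section \<open>Transfer to a canonical model\<close>

lemma distr_PiM_componentwise:
  fixes M :: "'i::finite \<Rightarrow> 'a measure" and N :: "'i \<Rightarrow> 'b measure"
  assumes M: "\<And>i. prob_space (M i)" and e: "\<And>i. e i \<in> measurable (M i) (N i)"
  shows "(\<lambda>x i. e i (x i)) \<in> measurable (PiM UNIV M) (PiM UNIV N)" (is ?m)
    and "distr (PiM UNIV M) (PiM UNIV N) (\<lambda>x i. e i (x i)) = PiM UNIV (\<lambda>i. distr (M i) (N i) (e i))"
proof -
  interpret P: prob_space "PiM UNIV M" using M by (rule prob_space_PiM)
  have comp: "(\<lambda>x. e i (x i)) \<in> measurable (PiM UNIV M) (N i)" for i
    using measurable_compose[OF measurable_component_singleton[of i UNIV M] e[of i]] by simp
  then have "(\<lambda>x. \<lambda>i\<in>UNIV. e i (x i)) \<in> measurable (PiM UNIV M) (PiM UNIV N)"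
    by (rule measurable_restrict)
  then show ?m by (simp add: restrict_UNIV)
  \<comment> \<open>Coordinatewise maps preserve independence, so the joint law of the images is the
    product of their marginals.\<close>
  have "P.indep_vars N (\<lambda>i x. e i (x i)) UNIV"
    using P.indep_vars_compose2[OF indep_vars_PiM_coordinates[of UNIV M], of e N] M e by simp
  then have "distr (PiM UNIV M) (PiM UNIV N) (\<lambda>x. \<lambda>i\<in>UNIV. e i (x i)) =
      PiM UNIV (\<lambda>i. distr (PiM UNIV M) (N i) (\<lambda>x. e i (x i)))"
    using comp by (subst (asm) P.indep_vars_iff_distr_eq_PiM') auto
  also have "(\<lambda>i. distr (PiM UNIV M) (N i) (\<lambda>x. e i (x i))) = (\<lambda>i. distr (M i) (N i) (e i))"
  proof
    fix i
    have "distr (PiM UNIV M) (N i) (\<lambda>x. e i (x i)) = distr (distr (PiM UNIV M) (M i) (\<lambda>x. x i)) (N i) (e i)"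
      by (subst distr_distr[OF e]) (auto simp: comp_def)
    also have "\<dots> = distr (M i) (N i) (e i)" using M by (simp add: distr_PiM_component)
    finally show "distr (PiM UNIV M) (N i) (\<lambda>x. e i (x i)) = distr (M i) (N i) (e i)" .
  qed
  finally show "distr (PiM UNIV M) (PiM UNIV N) (\<lambda>x i. e i (x i)) = PiM UNIV (\<lambda>i. distr (M i) (N i) (e i))"
    by (simp add: restrict_UNIV)
qed

text \<open>The new exogenous values are labels in \<open>nat\<close>, decoded to the old space by
  \<open>e\<close>. Decoding turns the label law into the pushed-forward law, which agrees with the
  old one on every response event and hence on their finite disjoint unions.\<close>

lemma exists_equivalent_canonical_scm:
  fixes pa :: "'v::finite \<Rightarrow> 'v set" and ex :: "'v \<Rightarrow> 'u::finite set" and \<mu> :: "'u \<Rightarrow> 'e measure"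
  assumes f: "compatible_scm pa ex \<Omega> \<mu> f" and \<Omega>: "\<forall>V. finite (\<Omega> V)"
  shows "\<exists>(\<nu> :: 'u \<Rightarrow> nat measure) g. canonical pa ex \<Omega> \<nu> \<and> compatible_scm pa ex \<Omega> \<nu> g \<and>
           (\<forall>evs. (\<forall>(x, y)\<in>set evs. realization \<Omega> x) \<longrightarrow> cf_prob \<nu> g evs = cf_prob \<mu> f evs)"
proof -
  obtain \<nu> :: "'u \<Rightarrow> nat measure" and e where
    \<nu>_all: "\<forall>U. prob_space (\<nu> U) \<and> sets (\<nu> U) = Pow {..<canon_card pa ex \<Omega> U} \<and>
              e U \<in> measurable (\<nu> U) (\<mu> U)"
    and law: "\<forall>h\<in>response_functions pa \<Omega> UNIV.
        measure (PiM UNIV (\<lambda>U. distr (\<nu> U) (\<mu> U) (e U))) (response_event pa \<Omega> \<mu> f UNIV h) =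
        measure (PiM UNIV \<mu>) (response_event pa \<Omega> \<mu> f UNIV h)"
    using discretize_exogenous_set[OF f \<Omega> finite_class.finite_UNIV]
    by (simp only: ball_UNIV UNIV_I if_True) blast
  from \<nu>_all have \<nu>: "prob_space (\<nu> U)" "sets (\<nu> U) = Pow {..<canon_card pa ex \<Omega> U}"
    "e U \<in> measurable (\<nu> U) (\<mu> U)" for U by auto
  let ?\<mu> = "\<lambda>U. distr (\<nu> U) (\<mu> U) (e U)"
  let ?e = "\<lambda>n U. e U (n U)"
  \<comment> \<open>Decoding before applying \<open>f\<close> keeps every potential response; as
    decoding is coordinatewise, \<open>g\<close> still reads only the labels of
    \<open>ex V\<close>.\<close>
  define g where "g = (\<lambda>V w n. f V w (?e n))"
  note e_meas = distr_PiM_componentwise(1)[of \<nu> e \<mu>, OF \<nu>(1,3)]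
  note e_distr = distr_PiM_componentwise(2)[of \<nu> e \<mu>, OF \<nu>(1,3)]
  have "canonical pa ex \<Omega> \<nu>"
    unfolding canonical_def by (intro allI exI[of _ "{..<canon_card pa ex \<Omega> _}"]) (simp add: \<nu>(2))
  moreover have "compatible_scm pa ex \<Omega> \<nu> g"
    unfolding compatible_scm_def
  proof (intro conjI allI impI)
    show "prob_space (\<nu> U)" for U by (rule \<nu>)
    show "(\<lambda>n. g V w n) \<in> measurable (PiM UNIV \<nu>) (count_space UNIV)" for V w
      unfolding g_def by (rule measurable_compose[OF e_meas compatible_scmD(2)[OF f]])
    show "g V w n \<in> \<Omega> V" if "n \<in> space (PiM UNIV \<nu>)" for V w n
      unfolding g_def by (rule compatible_scmD(3)[OF f measurable_space[OF e_meas that]])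
    show "g V w n = g V w' n'" if "\<forall>W\<in>pa V. w W = w' W" "\<forall>U\<in>ex V. n U = n' U" for V w w' n n'
      unfolding g_def by (rule compatible_scmD(4)[OF f]) (use that in auto)
  qed
  moreover have "cf_prob \<nu> g evs = cf_prob \<mu> f evs" if evs: "\<forall>(x, y)\<in>set evs. realization \<Omega> x" for evs
  proof -
    interpret P: prob_space "PiM UNIV \<mu>" using compatible_scmD(1)[OF f] by (rule prob_space_PiM)
    have "prob_space (?\<mu> U)" for U using \<nu> by (auto intro: prob_space.prob_space_distr)
    then interpret Q: prob_space "PiM UNIV ?\<mu>" by (rule prob_space_PiM)
    let ?A = "response_event pa \<Omega> \<mu> f UNIV"
    let ?S = "{u \<in> space (PiM UNIV \<mu>). cf_holds f evs u}"
    obtain G where G: "G \<subseteq> response_functions pa \<Omega> UNIV" "?S = (\<Union>h\<in>G. ?A h)"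
      using cf_event_decomposition[OF f evs] by blast
    have fin: "finite G" using G(1) finite_response_functions[OF \<Omega>] by (rule finite_subset)
    have disj: "disjoint_family_on ?A G" using G(1) disjoint_response_events
      by (rule disjoint_family_on_mono)
    have sets: "?A h \<in> sets (PiM UNIV \<mu>)" for h by (rule response_event_sets[OF f \<Omega>])
    have sets_eq: "sets (PiM UNIV ?\<mu>) = sets (PiM UNIV \<mu>)" by (intro sets_PiM_cong) auto
    have S: "?S \<in> sets (PiM UNIV \<mu>)" unfolding G(2) using fin sets by (intro sets.finite_UN) auto
    have holds: "cf_holds g evs n \<longleftrightarrow> cf_holds f evs (?e n)" for n
      by (simp add: cf_holds_def resp_def g_def)
    have "cf_prob \<nu> g evs = measure (PiM UNIV \<nu>) (?e -` ?S \<inter> space (PiM UNIV \<nu>))"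
      unfolding cf_prob_def holds using measurable_space[OF e_meas]
      by (intro arg_cong[where f = "measure _"]) auto
    also have "\<dots> = measure (PiM UNIV ?\<mu>) ?S"
      unfolding e_distr[symmetric] by (rule measure_distr[OF e_meas S, symmetric])
    also have "\<dots> = (\<Sum>h\<in>G. measure (PiM UNIV ?\<mu>) (?A h))"
      unfolding G(2) using sets sets_eq by (intro Q.finite_measure_finite_Union fin disj) auto
    also have "\<dots> = (\<Sum>h\<in>G. measure (PiM UNIV \<mu>) (?A h))"
      using law G(1) by (intro sum.cong) auto
    also have "\<dots> = measure (PiM UNIV \<mu>) ?S"
      unfolding G(2) using sets by (intro P.finite_measure_finite_Union[symmetric] fin disj) auto
    also have "\<dots> = cf_prob \<mu> f evs" by (simp add: cf_prob_def)
    finally show ?thesis .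
  qed
  ultimately show ?thesis by blast
qed

theorem theorem2:
  fixes pa :: "'v::finite \<Rightarrow> 'v set"
    and ex :: "'v \<Rightarrow> 'u::finite set"
    and \<Omega> :: "'v \<Rightarrow> 'd set"
    and Zs :: "('v \<rightharpoonup> 'd) set"
    and Pdist :: "('v \<rightharpoonup> 'd) \<Rightarrow> ('v \<Rightarrow> 'd) \<Rightarrow> real"
    and evs :: "(('v \<rightharpoonup> 'd) \<times> ('v \<rightharpoonup> 'd)) list"
    and l r :: real
  assumes "dag pa"
    and "\<forall>V. finite (\<Omega> V)"
    and "finite Zs" and "\<forall>z\<in>Zs. realization \<Omega> z"
    and "\<forall>(x, y)\<in>set evs. realization \<Omega> x \<and> realization \<Omega> y"
    and l_min: "\<exists>(\<mu> :: 'u \<Rightarrow> nat measure) f. canonical pa ex \<Omega> \<mu> \<and>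
                  feasible pa ex \<Omega> Zs Pdist \<mu> f \<and> cf_prob \<mu> f evs = l"
    and r_max: "\<exists>(\<mu> :: 'u \<Rightarrow> nat measure) f. canonical pa ex \<Omega> \<mu> \<and>
                  feasible pa ex \<Omega> Zs Pdist \<mu> f \<and> cf_prob \<mu> f evs = r"
    and l_r_bounds: "\<forall>(\<mu> :: 'u \<Rightarrow> nat measure) f. canonical pa ex \<Omega> \<mu> \<and>
                  feasible pa ex \<Omega> Zs Pdist \<mu> f \<longrightarrow> l \<le> cf_prob \<mu> f evs \<and> cf_prob \<mu> f evs \<le> r"
  shows "(\<exists>(\<mu> :: 'u \<Rightarrow> nat measure) f. feasible pa ex \<Omega> Zs Pdist \<mu> f \<and> cf_prob \<mu> f evs = l)
       \<and> (\<exists>(\<mu> :: 'u \<Rightarrow> nat measure) f. feasible pa ex \<Omega> Zs Pdist \<mu> f \<and> cf_prob \<mu> f evs = r)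
       \<and> (\<forall>(\<mu> :: 'u \<Rightarrow> 'e measure) f. feasible pa ex \<Omega> Zs Pdist \<mu> f
            \<longrightarrow> l \<le> cf_prob \<mu> f evs \<and> cf_prob \<mu> f evs \<le> r)"
proof (intro conjI allI impI)
  \<comment> \<open>Canonical models are themselves compatible with the diagram, so the optimal ones
    attain \<open>l\<close> and \<open>r\<close> in the larger class too.\<close>
  from l_min show "\<exists>(\<mu> :: 'u \<Rightarrow> nat measure) f. feasible pa ex \<Omega> Zs Pdist \<mu> f \<and> cf_prob \<mu> f evs = l"
    by blast
  from r_max show "\<exists>(\<mu> :: 'u \<Rightarrow> nat measure) f. feasible pa ex \<Omega> Zs Pdist \<mu> f \<and> cf_prob \<mu> f evs = r"
    by blast
next
  fix \<mu> :: "'u \<Rightarrow> 'e measure" and f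
  assume feas: "feasible pa ex \<Omega> Zs Pdist \<mu> f"
  then have f: "compatible_scm pa ex \<Omega> \<mu> f" by (simp add: feasible_def)
  obtain \<nu> :: "'u \<Rightarrow> nat measure" and g where \<nu>: "canonical pa ex \<Omega> \<nu>" "compatible_scm pa ex \<Omega> \<nu> g"
    and eq: "\<And>evs. \<forall>(x, y)\<in>set evs. realization \<Omega> x \<Longrightarrow> cf_prob \<nu> g evs = cf_prob \<mu> f evs"
    using exists_equivalent_canonical_scm[OF f assms(2)] by blast
  \<comment> \<open>The given interventional probabilities are counterfactual probabilities of
    single-pair events, so the equivalent canonical model inherits feasibility.\<close>
  have "cf_prob \<nu> g [(z, Some \<circ> v)] = cf_prob \<mu> f [(z, Some \<circ> v)]" if "z \<in> Zs" for z v
    by (rule eq) (use assms(4) that in simp)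
  then have "feasible pa ex \<Omega> Zs Pdist \<nu> g" using feas \<nu>(2) by (simp add: feasible_def)
  moreover have "cf_prob \<nu> g evs = cf_prob \<mu> f evs" by (rule eq) (use assms(5) in fast)
  ultimately have "l \<le> cf_prob \<mu> f evs \<and> cf_prob \<mu> f evs \<le> r" using l_r_bounds \<nu>(1) by metis
  then show "l \<le> cf_prob \<mu> f evs" "cf_prob \<mu> f evs \<le> r" by simp_all
qed

end
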